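(* For all partial multi-valued functions $f,g:\subseteq\mathbb{N}^{\mathbb{N}}\rightrightarrows\mathbb{N}^{\mathbb{N}}$: (1) if $g\le_{\mathrm W} f$, then $\mathsf{T}g\le_{\mathrm W}\mathsf{tJ}(f)$; (2) there is $h:\subseteq\mathbb{N}^{\mathbb{N}}\rightrightarrows\mathbb{N}^{\mathbb{N}}$ such that $h\equiv_{\mathrm W} f$ and $\mathsf{tJ}(f)\equiv_{\mathrm W}\mathsf{T}h$. In other words, the Weihrauch degree of $\mathsf{tJ}(f)$ is the maximum of the Weihrauch degrees of the totalizations $\mathsf{T}g$ of those $g$ which are Weihrauch equivalent (equivalently, Weihrauch reducible) to $f$.
   Context: A problem is a partial multi-valued function $f:\subseteq\mathbb{N}^{\mathbb{N}}\rightrightarrows\mathbb{N}^{\mathbb{N}}$: it assigns to each $p\in\mathbb{N}^{\mathbb{N}}$ a set $f(p)\subseteq\mathbb{N}^{\mathbb{N}}$, and $\mathrm{dom}(f)=\{p: f(p)\ne\emptyset\}$. $f\le_{\mathrm W} g$ (Weihrauch reducible) means there are partial computable functionals $\Phi:\subseteq\mathbb{N}^{\mathbb{N}}\to\mathbb{N}^{\mathbb{N}}$ and $\Psi:\subseteq\mathbb{N}^{\mathbb{N}}\times\mathbb{N}^{\mathbb{N}}\to\mathbb{N}^{\mathbb{N}}$ such that for every $p\in\mathrm{dom}(f)$: $\Phi(p)\in\mathrm{dom}(g)$ and $\Psi(p,q)\in f(p)$ for every $q\in g(\Phi(p))$. $f\equiv_{\mathrm W} g$ means $f\le_{\mathrm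 W} g$ and $g\le_{\mathrm W} f$; Weihrauch degrees are the equivalence classes. Finite products of copies of $\mathbb{N}$ and $\mathbb{N}^{\mathbb{N}}$ are identified with $\mathbb{N}^{\mathbb{N}}$ via standard computable codings. $(\Phi_e)_{e\in\mathbb{N}}$ is a fixed standard computable enumeration of the partial computable functionals on $\mathbb{N}^{\mathbb{N}}$; $\Phi_i(p,q)$ means $\Phi_i$ applied to the pair $(p,q)$; $\downarrow$ means defined (an infinite sequence is output). Tot-jump: for $e,i\in\mathbb{N}$, $p\in\mathbb{N}^{\mathbb{N}}$, $\mathsf{tJ}(f)(e,i,p)=\{\Phi_i(p,q): q\in f(\Phi_e(p))\}$ if $\Phi_e(p)\in\mathrm{dom}(f)$ (in particular $\Phi_e(p)\downarrow$) and $\Phi_i(p,q)\downarrow$ for all $q\in f(\Phi_e(p))$; otherwise $\mathsf{tJ}(f)(e,i,p)=\mathbb{N}^{\mathbb{N}}$. Totalization: $\mathsf{T}f(x)=f(x)$ if $x\in\mathrm{dom}(f)$ and $\mathsf{T}f(x)=\mathbb{N}^{\mathbb{N}}$ otherwise. *)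

theory Defs
  imports Main "HOL-Library.Nat_Bijection"
begin

section \<open>Partial computable functionals on Baire space\<close>

type_synonym baire = "nat \<Rightarrow> nat"

text \<open>
  Partial computability relative to an oracle is Kleene's: the oracle is a basic function, and the
  partial recursive functions are closed under composition, primitive recursion and
  minimization.  All functions are unary; several arguments are packed with the Cantor pairing
  \<^const>\<open>prod_encode\<close>.
\<close>

datatype code =
    Zero
  | Succ
  | Fst
  | Snd
  | Oracle
  | Pairing code code
  | Compose code code
  | PrimRec code code
  | Minimize code

text \<open>
  \<open>run p c x\<close> is the value, if any, of program \<open>c\<close> with oracle \<open>p\<close> on input \<open>x\<close>; \<^const>\<open>None\<close>
  means divergence.  Minimization requires, as usual, that all values before the first zero
  are defined.
\<close>

primrec run :: "baire \<Rightarrow> code \<Rightarrow> nat \<Rightarrow> nat option" where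
  "run p Zero x = Some 0"
| "run p Succ x = Some (Suc x)"
| "run p Fst x = Some (fst (prod_decode x))"
| "run p Snd x = Some (snd (prod_decode x))"
| "run p Oracle x = Some (p x)"
| "run p (Pairing c d) x =
     Option.bind (run p c x) (\<lambda>a. Option.bind (run p d x) (\<lambda>b. Some (prod_encode (a, b))))"
| "run p (Compose c d) x = Option.bind (run p d x) (run p c)"
| "run p (PrimRec c d) x =
     (case prod_decode x of (a, n) \<Rightarrow>
        rec_nat (run p c a)
          (\<lambda>m r. Option.bind r (\<lambda>y. run p d (prod_encode (a, prod_encode (m, y))))) n)"
| "run p (Minimize c) x =
     (if \<exists>n. run p c (prod_encode (x, n)) = Some 0 \<and>
             (\<forall>m<n. run p c (prod_encode (x, m)) \<noteq> None)
      then Some (LEAST n. run p c (prod_encode (x, n)) = Some 0)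
      else None)"

text \<open>The functional is defined at \<open>p\<close> only if a complete infinite sequence is output.\<close>

definition functional_of :: "code \<Rightarrow> baire \<Rightarrow> baire option" where
  "functional_of c p =
     (if \<forall>n. run p c n \<noteq> None then Some (\<lambda>n. the (run p c n)) else None)"

definition partial_computable :: "(baire \<Rightarrow> baire option) \<Rightarrow> bool" where
  "partial_computable F \<longleftrightarrow> (\<exists>c. F = functional_of c)"

text \<open>
  Goedel numbering: a number is read as a pair of a tag selecting the constructor and an argument
  holding the numbers of the immediate subprograms.  Every number denotes a program.
\<close>

lemma snd_prod_decode_less: "fst (prod_decode n) \<noteq> 0 \<Longrightarrow> snd (prod_decode n) < n"
proof -
  assume ne: "fst (prod_decode n) \<noteq> 0"
  obtain k r where kr: "prod_decode n = (k, r)" by fastforce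
  then have "n = prod_encode (k, r)" by (metis prod_decode_inverse)
  moreover have "r \<le> triangle (k + r)" if "k \<noteq> 0"
    using that by (induction k) (auto simp: triangle_def)
  ultimately show ?thesis using ne kr by (simp add: prod_encode_def)
qed

lemma fst_prod_decode_le: "fst (prod_decode n) \<le> n"
  by (metis le_prod_encode_1 prod.collapse prod_decode_inverse)

lemma snd_prod_decode_le: "snd (prod_decode n) \<le> n"
  by (metis le_prod_encode_2 prod.collapse prod_decode_inverse)

function decode :: "nat \<Rightarrow> code" where
  "decode n =
     (let k = fst (prod_decode n); r = snd (prod_decode n) in
      if k = 0 then Zero
      else if k = 1 then Succ
      else if k = 2 then Fst
      else if k = 3 then Snd
      else if k = 4 then Oracle
      else if k = 5 then Pairing (decode (fst (prod_decode r))) (decode (snd (prod_decode r)))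
      else if k = 6 then Compose (decode (fst (prod_decode r))) (decode (snd (prod_decode r)))
      else if k = 7 then PrimRec (decode (fst (prod_decode r))) (decode (snd (prod_decode r)))
      else Minimize (decode r))"
  by pat_completeness auto
termination
  by (relation "measure id")
     (simp_all add: snd_prod_decode_less le_less_trans[OF fst_prod_decode_le snd_prod_decode_less]
        le_less_trans[OF snd_prod_decode_le snd_prod_decode_less])

declare decode.simps [simp del]

definition Phi :: "nat \<Rightarrow> baire \<Rightarrow> baire option" where
  "Phi e = functional_of (decode e)"

lemma decode_surj: "\<exists>e. decode e = c"
proof (induction c)
  case Zero
  show ?case by (rule exI[of _ "prod_encode (0, 0)"]) (simp add: decode.simps)
next
  case Succ
  show ?case by (rule exI[of _ "prod_encode (1, 0)"]) (simp add: decode.simps)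
next
  case Fst
  show ?case by (rule exI[of _ "prod_encode (2, 0)"]) (simp add: decode.simps)
next
  case Snd
  show ?case by (rule exI[of _ "prod_encode (3, 0)"]) (simp add: decode.simps)
next
  case Oracle
  show ?case by (rule exI[of _ "prod_encode (4, 0)"]) (simp add: decode.simps)
next
  case (Pairing c d)
  then obtain a b where "decode a = c" "decode b = d" by blast
  then show ?case
    by (intro exI[of _ "prod_encode (5, prod_encode (a, b))"])
       (simp add: decode.simps[of "prod_encode (5, _)"])
next
  case (Compose c d)
  then obtain a b where "decode a = c" "decode b = d" by blast
  then show ?case
    by (intro exI[of _ "prod_encode (6, prod_encode (a, b))"])
       (simp add: decode.simps[of "prod_encode (6, _)"])
next
  case (PrimRec c d)
  then obtain a b where "decode a = c" "decode b = d" by blast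
  then show ?case
    by (intro exI[of _ "prod_encode (7, prod_encode (a, b))"])
       (simp add: decode.simps[of "prod_encode (7, _)"])
next
  case (Minimize c)
  then obtain a where "decode a = c" by blast
  then show ?case
    by (intro exI[of _ "prod_encode (8, a)"])
       (simp add: decode.simps[of "prod_encode (8, _)"])
qed

lemma range_Phi: "range Phi = Collect partial_computable"
proof -
  have "functional_of c \<in> range Phi" for c
    by (metis Phi_def decode_surj rangeI)
  then show ?thesis by (auto simp: partial_computable_def Phi_def)
qed

section \<open>Problems and Weihrauch reducibility\<close>

text \<open>A partial multi-valued function is undefined exactly where its value is the empty set.\<close>

type_synonym problem = "baire \<Rightarrow> baire set"

definition pdom :: "problem \<Rightarrow> baire set" where
  "pdom f = {p. f p \<noteq> {}}"

text \<open>
  The codings of pairs of sequences and of triples in $\mathbb{N} \times \mathbb{N} \times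
  \mathbb{N}^{\mathbb{N}}$ are bijections onto Baire space: interleaving, and prefixing
  the two numbers.
\<close>

definition bpair :: "baire \<Rightarrow> baire \<Rightarrow> baire" where
  "bpair p q = (\<lambda>n. if even n then p (n div 2) else q (n div 2))"

definition btriple :: "nat \<Rightarrow> nat \<Rightarrow> baire \<Rightarrow> baire" where
  "btriple e i p = case_nat e (case_nat i p)"

lemma btriple_collapse: "btriple (x 0) (x 1) (\<lambda>n. x (n + 2)) = x"
  by (rule ext) (simp add: btriple_def split: nat.split)

definition weihrauch_le :: "problem \<Rightarrow> problem \<Rightarrow> bool" (infix "\<le>\<^sub>W" 50) where
  "f \<le>\<^sub>W g \<longleftrightarrow>
     (\<exists>F G. partial_computable F \<and> partial_computable G \<and>
        (\<forall>p\<in>pdom f. \<exists>r. F p = Some r \<and> r \<in> pdom g \<and>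
           (\<forall>q\<in>g r. \<exists>s. G (bpair p q) = Some s \<and> s \<in> f p)))"

definition weihrauch_equiv :: "problem \<Rightarrow> problem \<Rightarrow> bool" (infix "\<equiv>\<^sub>W" 50) where
  "f \<equiv>\<^sub>W g \<longleftrightarrow> f \<le>\<^sub>W g \<and> g \<le>\<^sub>W f"

definition weihrauch_degree :: "problem \<Rightarrow> problem set" where
  "weihrauch_degree f = {g. g \<equiv>\<^sub>W f}"

definition degree_le :: "problem set \<Rightarrow> problem set \<Rightarrow> bool" where
  "degree_le A B \<longleftrightarrow> (\<exists>f\<in>A. \<exists>g\<in>B. f \<le>\<^sub>W g)"

definition is_max_degree :: "problem set \<Rightarrow> problem set set \<Rightarrow> bool" where
  "is_max_degree D S \<longleftrightarrow> D \<in> S \<and> (\<forall>E\<in>S. degree_le E D)"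

section \<open>Totalization and tot-jump\<close>

definition totalization :: "problem \<Rightarrow> problem" where
  "totalization f x = (if x \<in> pdom f then f x else UNIV)"

definition tot_jump_at :: "problem \<Rightarrow> nat \<Rightarrow> nat \<Rightarrow> baire \<Rightarrow> baire set" where
  "tot_jump_at f e i p =
     (if \<exists>r. Phi e p = Some r \<and> r \<in> pdom f \<and> (\<forall>q\<in>f r. Phi i (bpair p q) \<noteq> None)
      then {the (Phi i (bpair p q)) | q. q \<in> f (the (Phi e p))}
      else UNIV)"

text \<open>By \<open>btriple_collapse\<close>, \<open>x\<close> codes the triple used here.\<close>

definition tot_jump :: "problem \<Rightarrow> problem" where
  "tot_jump f x = tot_jump_at f (x 0) (x 1) (\<lambda>n. x (n + 2))"

lemma tot_jump_btriple: "tot_jump f (btriple e i p) = tot_jump_at f e i p"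
  by (simp add: tot_jump_def btriple_def)

end

theory Submission
  imports Defs
begin

text \<open>
  The problem \<open>h\<close> of the second part is the tot-jump restricted to the triples \<open>(e, i, p)\<close> on which
  \<open>\<Phi>\<^sub>e\<close> and \<open>\<Phi>\<^sub>i\<close> really do act as a reduction to \<open>f\<close> at \<open>p\<close>; its totalization is the tot-jump
  itself.  It reduces to \<open>f\<close> because \<open>\<Phi>\<^sub>e(p)\<close> and \<open>\<Phi>\<^sub>i(p, q)\<close> are computable uniformly in the
  indices, and \<open>f\<close> reduces to it by fixing indices of the identity and of the second projection.
  Conversely, if \<open>g\<close> reduces to \<open>f\<close> by \<open>\<Phi>\<^sub>e\<close> and \<open>\<Phi>\<^sub>i\<close>, then \<open>p \<mapsto> (e, i, p)\<close> reduces the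
  totalization of \<open>g\<close> to the tot-jump: on the domain of \<open>g\<close> the answers are solutions, and
  elsewhere every answer is allowed, while the tot-jump is never empty.  The statements on maximal
  degrees follow from these two facts.

  The substance is therefore the existence of a universal program (\<open>universal_program\<close>): the
  programs are trees interpreted by structural recursion, whereas the interpreter has to be such a
  program itself.  A stack machine works on numbers that code a program number, its argument
  and a stack of pending operations.  One step is a case distinction on codes, hence computable;
  the number of steps until the machine halts is found by minimization.  The machine is correct
  (\<open>machine_correct\<close>) in the strong sense that divergence of a program means that the machine
  never halts, whatever is on the stack.  Finally, a program can be run relative to a computable
  transformation of its oracle (\<open>oracle_substitution\<close>), which extracts \<open>p\<close> from the triple
  \<open>(e, i, p)\<close>.
\<close>

section \<open>Total computable functions relative to an oracle\<close>

definition total_computable :: "(baire \<Rightarrow> nat \<Rightarrow> nat) \<Rightarrow> bool" where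
  "total_computable F \<longleftrightarrow> (\<exists>c. \<forall>p x. run p c x = Some (F p x))"

abbreviation npair :: "nat \<Rightarrow> nat \<Rightarrow> nat" ("\<langle>_,/ _\<rangle>") where
  "\<langle>a, b\<rangle> \<equiv> prod_encode (a, b)"

abbreviation nfst :: "nat \<Rightarrow> nat" where
  "nfst n \<equiv> fst (prod_decode n)"

abbreviation nsnd :: "nat \<Rightarrow> nat" where
  "nsnd n \<equiv> snd (prod_decode n)"

lemma total_computable_compose:
  assumes "total_computable F" "total_computable G"
  shows "total_computable (\<lambda>p x. F p (G p x))"
proof -
  obtain c d where "\<forall>p x. run p c x = Some (F p x)" "\<forall>p x. run p d x = Some (G p x)"
    using assms by (auto simp: total_computable_def)
  then have "\<forall>p x. run p (Compose c d) x = Some (F p (G p x))" by simp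
  then show ?thesis unfolding total_computable_def by blast
qed

lemma total_computable_pair:
  assumes "total_computable F" "total_computable G"
  shows "total_computable (\<lambda>p x. \<langle>F p x, G p x\<rangle>)"
proof -
  obtain c d where "\<forall>p x. run p c x = Some (F p x)" "\<forall>p x. run p d x = Some (G p x)"
    using assms by (auto simp: total_computable_def)
  then have "\<forall>p x. run p (Pairing c d) x = Some \<langle>F p x, G p x\<rangle>" by simp
  then show ?thesis unfolding total_computable_def by blast
qed

lemma total_computable_fst_basic: "total_computable (\<lambda>p x. nfst x)"
  unfolding total_computable_def by (rule exI[of _ Fst]) simp

lemma total_computable_snd_basic: "total_computable (\<lambda>p x. nsnd x)"
  unfolding total_computable_def by (rule exI[of _ Snd]) simp

lemma total_computable_id: "total_computable (\<lambda>p x. x)"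
  using total_computable_pair[OF total_computable_fst_basic total_computable_snd_basic] by simp

lemma total_computable_fst: "total_computable F \<Longrightarrow> total_computable (\<lambda>p x. nfst (F p x))"
  by (rule total_computable_compose[OF total_computable_fst_basic])

lemma total_computable_snd: "total_computable F \<Longrightarrow> total_computable (\<lambda>p x. nsnd (F p x))"
  by (rule total_computable_compose[OF total_computable_snd_basic])

lemma total_computable_Suc:
  assumes "total_computable F"
  shows "total_computable (\<lambda>p x. Suc (F p x))"
proof -
  have "total_computable (\<lambda>p. Suc)"
    unfolding total_computable_def by (rule exI[of _ Succ]) simp
  then show ?thesis using assms by (rule total_computable_compose)
qed

lemma total_computable_oracle:
  assumes "total_computable F"
  shows "total_computable (\<lambda>p x. p (F p x))"
proof -
  have "total_computable (\<lambda>p. p)"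
    unfolding total_computable_def by (rule exI[of _ Oracle]) simp
  then show ?thesis using assms by (rule total_computable_compose)
qed

lemma total_computable_const: "total_computable (\<lambda>p x. n)"
proof (induction n)
  case 0
  show ?case unfolding total_computable_def by (rule exI[of _ Zero]) simp
next
  case (Suc n)
  then show ?case by (rule total_computable_Suc)
qed

lemma total_computable_rec:
  assumes "total_computable A" "total_computable S" "total_computable N"
  shows "total_computable (\<lambda>p x. rec_nat (A p x) (\<lambda>m y. S p \<langle>x, \<langle>m, y\<rangle>\<rangle>) (N p x))"
proof -
  obtain a s where a: "\<And>p x. run p a x = Some (A p x)" and s: "\<And>p x. run p s x = Some (S p x)"
    using assms by (auto simp: total_computable_def)
  have "run p (PrimRec a s) \<langle>x, n\<rangle> =
      Some (rec_nat (A p x) (\<lambda>m y. S p \<langle>x, \<langle>m, y\<rangle>\<rangle>) n)" for p x n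
    by (induction n) (simp_all add: a s)
  then have "run p (PrimRec a s) z =
      Some (rec_nat (A p (nfst z)) (\<lambda>m y. S p \<langle>nfst z, \<langle>m, y\<rangle>\<rangle>) (nsnd z))" for p z
    by (metis prod.collapse prod_decode_inverse)
  then have "total_computable
      (\<lambda>p z. rec_nat (A p (nfst z)) (\<lambda>m y. S p \<langle>nfst z, \<langle>m, y\<rangle>\<rangle>) (nsnd z))"
    unfolding total_computable_def by blast
  from total_computable_compose[OF this total_computable_pair[OF total_computable_id assms(3)]]
  show ?thesis by simp
qed

lemma total_computable_if_zero:
  assumes "total_computable N" "total_computable A" "total_computable B"
  shows "total_computable (\<lambda>p x. if N p x = 0 then A p x else B p x)"
proof -
  have "total_computable (\<lambda>p z. B p (nfst z))"
    by (intro total_computable_compose[OF assms(3)] total_computable_fst total_computable_id)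
  from total_computable_rec[OF assms(2) this assms(1)]
  have "total_computable (\<lambda>p x. rec_nat (A p x) (\<lambda>m y. B p x) (N p x))" by simp
  moreover have "rec_nat u (\<lambda>m y. v) n = (if n = 0 then u else v)" for u v n :: nat
    by (cases n) simp_all
  ultimately show ?thesis by simp
qed

lemma total_computable_pred:
  assumes "total_computable N"
  shows "total_computable (\<lambda>p x. N p x - 1)"
proof -
  have "total_computable (\<lambda>p z. nfst (nsnd z))"
    by (intro total_computable_fst total_computable_snd total_computable_id)
  from total_computable_rec[OF total_computable_const this assms, of 0]
  have "total_computable (\<lambda>p x. rec_nat 0 (\<lambda>m y. m) (N p x))" by simp
  moreover have "rec_nat 0 (\<lambda>m y. m) n = n - 1" for n :: nat
    by (cases n) simp_all
  ultimately show ?thesis by simp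
qed

lemma total_computable_if_eq:
  assumes "total_computable A" "total_computable B"
  shows "total_computable N \<Longrightarrow> total_computable (\<lambda>p x. if N p x = k then A p x else B p x)"
proof (induction k arbitrary: N)
  case 0
  then show ?case using assms by (intro total_computable_if_zero)
next
  case (Suc k)
  have "(\<lambda>p x. if N p x = Suc k then A p x else B p x) =
      (\<lambda>p x. if N p x = 0 then B p x else if N p x - 1 = k then A p x else B p x)"
    by (intro ext) auto
  moreover have "total_computable
      (\<lambda>p x. if N p x = 0 then B p x else if N p x - 1 = k then A p x else B p x)"
    using assms Suc.prems by (intro total_computable_if_zero Suc.IH total_computable_pred)
  ultimately show ?case by simp
qed

lemma total_computable_funpow:
  assumes "total_computable S" "total_computable A" "total_computable N"
  shows "total_computable (\<lambda>p x. (S p ^^ N p x) (A p x))"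
proof -
  have "total_computable (\<lambda>p z. S p (nsnd (nsnd z)))"
    by (intro total_computable_compose[OF assms(1)] total_computable_snd total_computable_id)
  from total_computable_rec[OF assms(2) this assms(3)]
  have "total_computable (\<lambda>p x. rec_nat (A p x) (\<lambda>m y. S p y) (N p x))" by simp
  moreover have "rec_nat u (\<lambda>m y. S p y) n = (S p ^^ n) u" for p u n
    by (induction n) simp_all
  ultimately show ?thesis by simp
qed

lemmas total_computable_intros =
  total_computable_id total_computable_const total_computable_Suc total_computable_oracle
  total_computable_fst total_computable_snd total_computable_pair total_computable_pred
  total_computable_if_eq

lemma total_computable_parity_if:
  assumes "total_computable N" "total_computable A" "total_computable B"
  shows "total_computable (\<lambda>p x. if even (N p x) then A p x else B p x)"
proof -
  have "total_computable (\<lambda>p z. if nsnd (nsnd z) = 0 then 1 else 0)"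
    by (intro total_computable_intros)
  from total_computable_rec[OF total_computable_const this assms(1), of 0]
  have "total_computable (\<lambda>p x. rec_nat 0 (\<lambda>m y. if y = 0 then 1 else 0) (N p x))" by simp
  moreover have "rec_nat 0 (\<lambda>m y. if y = 0 then 1 else 0) n = n mod 2" for n :: nat
    by (induction n) (auto simp: mod_Suc)
  ultimately have "total_computable (\<lambda>p x. N p x mod 2)" by simp
  from total_computable_if_eq[OF assms(2,3) this, of 0]
  show ?thesis by (simp add: even_iff_mod_2_eq_zero)
qed

lemma total_computable_double:
  assumes "total_computable N"
  shows "total_computable (\<lambda>p x. 2 * N p x)"
proof -
  have "total_computable (\<lambda>p z. Suc (Suc (nsnd (nsnd z))))"
    by (intro total_computable_intros)
  from total_computable_rec[OF total_computable_const this assms, of 0]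
  have "total_computable (\<lambda>p x. rec_nat 0 (\<lambda>m y. Suc (Suc y)) (N p x))" by simp
  moreover have "rec_nat 0 (\<lambda>m y. Suc (Suc y)) n = 2 * n" for n :: nat
    by (induction n) simp_all
  ultimately show ?thesis by simp
qed

text \<open>
  Replacing every oracle call by a program for \<open>A\<close> turns a computation with oracle \<open>A p\<close> into one
  with oracle \<open>p\<close>, preserving divergence because \<open>A\<close> is total.
\<close>

lemma oracle_substitution:
  assumes "total_computable A"
  shows "\<exists>c'. \<forall>p x. run p c' x = run (A p) c x"
proof -
  obtain a where a: "\<And>p x. run p a x = Some (A p x)"
    using assms by (auto simp: total_computable_def)
  show ?thesis
  proof (induction c)
    case Zero
    show ?case by (rule exI[of _ Zero]) simp
  next
    case Succ
    show ?case by (rule exI[of _ Succ]) simp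
  next
    case Fst
    show ?case by (rule exI[of _ Fst]) simp
  next
    case Snd
    show ?case by (rule exI[of _ Snd]) simp
  next
    case Oracle
    show ?case by (rule exI[of _ a]) (simp add: a)
  next
    case (Pairing c d)
    then obtain c' d' where "\<And>p x. run p c' x = run (A p) c x" "\<And>p x. run p d' x = run (A p) d x"
      by blast
    then show ?case by (intro exI[of _ "Pairing c' d'"]) simp
  next
    case (Compose c d)
    then obtain c' d' where "\<And>p. run p c' = run (A p) c" "\<And>p x. run p d' x = run (A p) d x"
      by (metis ext)
    then show ?case by (intro exI[of _ "Compose c' d'"]) simp
  next
    case (PrimRec c d)
    then obtain c' d' where "\<And>p x. run p c' x = run (A p) c x" "\<And>p x. run p d' x = run (A p) d x"
      by blast
    then show ?case by (intro exI[of _ "PrimRec c' d'"]) simp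
  next
    case (Minimize c)
    then obtain c' where "\<And>p x. run p c' x = run (A p) c x" by blast
    then show ?case by (intro exI[of _ "Minimize c'"]) simp
  qed
qed

section \<open>A stack machine that evaluates program numbers\<close>

text \<open>
  A state of the machine is a number.  It either asks for the value of program number \<open>e\<close> at \<open>x\<close>, to
  be handed to the stack \<open>k\<close>, or it hands the value \<open>v\<close> to \<open>k\<close>.
\<close>

definition Eval :: "nat \<Rightarrow> nat \<Rightarrow> nat \<Rightarrow> nat" where
  "Eval e x k = \<langle>0, \<langle>\<langle>e, x\<rangle>, k\<rangle>\<rangle>"

definition Return :: "nat \<Rightarrow> nat \<Rightarrow> nat" where
  "Return v k = \<langle>1, \<langle>v, k\<rangle>\<rangle>"

text \<open>
  A stack is \<open>\<langle>t, \<langle>w, k\<rangle>\<rangle>\<close> where the tag \<open>t\<close> names the pending operation, \<open>w\<close> holds its data and \<open>k\<close>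
  is the rest of the stack.  Tag 0 means that nothing is pending; in particular \<open>0\<close> codes the empty
  stack, and the machine stops by repeating its state.  Tags 1 and 2 wait for the first and the second component of a pair, and tag 3 for the
  argument of a composition.  Tag 4 with data \<open>\<langle>d, \<langle>a, \<langle>m, n\<rangle>\<rangle>\<rangle>\<close> waits for the \<open>m\<close>-th value of a primitive
  recursion with \<open>n\<close> rounds to go, and tag 5 with data \<open>\<langle>c, \<langle>x, m\<rangle>\<rangle>\<close> for the \<open>m\<close>-th value of a search.
\<close>

definition eval_step :: "baire \<Rightarrow> nat \<Rightarrow> nat \<Rightarrow> nat \<Rightarrow> nat \<Rightarrow> nat" where
  "eval_step p j r x k =
     (if j = 0 then Return 0 k
      else if j = 1 then Return (Suc x) k
      else if j = 2 then Return (nfst x) k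
      else if j = 3 then Return (nsnd x) k
      else if j = 4 then Return (p x) k
      else if j = 5 then Eval (nfst r) x \<langle>1, \<langle>\<langle>nsnd r, x\<rangle>, k\<rangle>\<rangle>
      else if j = 6 then Eval (nsnd r) x \<langle>3, \<langle>nfst r, k\<rangle>\<rangle>
      else if j = 7 then Eval (nfst r) (nfst x) \<langle>4, \<langle>\<langle>nsnd r, \<langle>nfst x, \<langle>0, nsnd x\<rangle>\<rangle>\<rangle>, k\<rangle>\<rangle>
      else Eval r \<langle>x, 0\<rangle> \<langle>5, \<langle>\<langle>r, \<langle>x, 0\<rangle>\<rangle>, k\<rangle>\<rangle>)"

definition primrec_step :: "nat \<Rightarrow> nat \<Rightarrow> nat \<Rightarrow> nat \<Rightarrow> nat \<Rightarrow> nat \<Rightarrow> nat" where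
  "primrec_step v d a m n k =
     (if n = 0 then Return v k
      else Eval d \<langle>a, \<langle>m, v\<rangle>\<rangle> \<langle>4, \<langle>\<langle>d, \<langle>a, \<langle>Suc m, n - 1\<rangle>\<rangle>\<rangle>, k\<rangle>\<rangle>)"

definition minimize_step :: "nat \<Rightarrow> nat \<Rightarrow> nat \<Rightarrow> nat \<Rightarrow> nat \<Rightarrow> nat" where
  "minimize_step v c x m k =
     (if v = 0 then Return m k
      else Eval c \<langle>x, Suc m\<rangle> \<langle>5, \<langle>\<langle>c, \<langle>x, Suc m\<rangle>\<rangle>, k\<rangle>\<rangle>)"

definition return_step :: "nat \<Rightarrow> nat \<Rightarrow> nat \<Rightarrow> nat \<Rightarrow> nat" where
  "return_step v t w k =
     (if t = 0 then Return v \<langle>t, \<langle>w, k\<rangle>\<rangle>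
      else if t = 1 then Eval (nfst w) (nsnd w) \<langle>2, \<langle>v, k\<rangle>\<rangle>
      else if t = 2 then Return \<langle>w, v\<rangle> k
      else if t = 3 then Eval w v k
      else if t = 4 then
        primrec_step v (nfst w) (nfst (nsnd w)) (nfst (nsnd (nsnd w))) (nsnd (nsnd (nsnd w))) k
      else minimize_step v (nfst w) (nfst (nsnd w)) (nsnd (nsnd w)) k)"

definition step :: "baire \<Rightarrow> nat \<Rightarrow> nat" where
  "step p s =
     (if nfst s = 0
      then eval_step p (nfst (nfst (nfst (nsnd s)))) (nsnd (nfst (nfst (nsnd s))))
             (nsnd (nfst (nsnd s))) (nsnd (nsnd s))
      else return_step (nfst (nsnd s)) (nfst (nsnd (nsnd s))) (nfst (nsnd (nsnd (nsnd s))))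
             (nsnd (nsnd (nsnd (nsnd s)))))"

definition halted :: "nat \<Rightarrow> bool" where
  "halted s \<longleftrightarrow> nfst s = 1 \<and> nfst (nsnd (nsnd s)) = 0"

lemma step_Eval [simp]: "step p (Eval \<langle>j, r\<rangle> x k) = eval_step p j r x k"
  by (simp add: step_def Eval_def)

lemma step_Return [simp]: "step p (Return v \<langle>t, \<langle>w, k\<rangle>\<rangle>) = return_step v t w k"
  by (simp add: step_def Return_def)

lemma not_halted_Eval [simp]: "\<not> halted (Eval e x k)"
  by (simp add: halted_def Eval_def)

lemma halted_Return_empty [simp]: "halted (Return v 0)"
proof -
  have "prod_decode 0 = (0, 0)" by (simp add: prod_decode_def prod_decode_aux.simps)
  then show ?thesis by (simp add: halted_def Return_def)
qed

lemma step_halted: "halted s \<Longrightarrow> step p s = s"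
proof -
  assume "halted s"
  moreover obtain i v t w k where "s = \<langle>i, \<langle>v, \<langle>t, \<langle>w, k\<rangle>\<rangle>\<rangle>\<rangle>"
    by (metis prod.collapse prod_decode_inverse)
  ultimately show ?thesis
    by (simp add: halted_def step_def return_step_def Return_def)
qed

lemma total_computable_Eval:
  assumes "total_computable E" "total_computable X" "total_computable K"
  shows "total_computable (\<lambda>p s. Eval (E p s) (X p s) (K p s))"
  unfolding Eval_def by (intro total_computable_intros assms)

lemma total_computable_Return:
  assumes "total_computable V" "total_computable K"
  shows "total_computable (\<lambda>p s. Return (V p s) (K p s))"
  unfolding Return_def by (intro total_computable_intros assms)

lemma total_computable_step: "total_computable step"
  unfolding step_def eval_step_def return_step_def primrec_step_def minimize_step_def
  by (intro total_computable_intros total_computable_Eval total_computable_Return)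

section \<open>Correctness of the machine\<close>

definition halts :: "baire \<Rightarrow> nat \<Rightarrow> bool" where
  "halts p s \<longleftrightarrow> (\<exists>t. halted ((step p ^^ t) s))"

text \<open>The specification of a state that is to hand the possibly undefined value \<open>r\<close> to stack \<open>k\<close>.\<close>

definition delivers :: "baire \<Rightarrow> nat \<Rightarrow> nat option \<Rightarrow> nat \<Rightarrow> bool" where
  "delivers p s r k =
     (case r of Some v \<Rightarrow> \<exists>t. (step p ^^ t) s = Return v k | None \<Rightarrow> \<not> halts p s)"

lemma funpow_step_halted: "halted s \<Longrightarrow> (step p ^^ t) s = s"
  by (induction t) (simp_all add: step_halted)

lemma halted_persists:
  assumes "halted ((step p ^^ t) s)" "t \<le> u"
  shows "(step p ^^ u) s = (step p ^^ t) s"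
proof -
  have "(step p ^^ u) s = (step p ^^ (u - t)) ((step p ^^ t) s)"
    using assms(2) funpow_add[of "u - t" t "step p"] by simp
  then show ?thesis using assms(1) by (simp add: funpow_step_halted)
qed

lemma halts_funpow: "halts p ((step p ^^ t) s) \<longleftrightarrow> halts p s"
proof
  show "halts p s" if "halts p ((step p ^^ t) s)"
  proof -
    obtain u where "halted ((step p ^^ u) ((step p ^^ t) s))"
      using \<open>halts p ((step p ^^ t) s)\<close> unfolding halts_def by blast
    then have "halted ((step p ^^ (u + t)) s)" by (simp add: funpow_add)
    then show ?thesis unfolding halts_def by blast
  qed
  show "halts p ((step p ^^ t) s)" if "halts p s"
  proof -
    obtain u where u: "halted ((step p ^^ u) s)" using \<open>halts p s\<close> unfolding halts_def by blast
    then have "halted ((step p ^^ (u + t)) s)" by (simp add: halted_persists[OF u, of "u + t"])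
    then have "halted ((step p ^^ u) ((step p ^^ t) s))" by (simp add: funpow_add)
    then show ?thesis unfolding halts_def by blast
  qed
qed

lemma delivers_Return: "delivers p (Return v k) (Some v) k"
  unfolding delivers_def by (auto intro: exI[of _ 0])

lemma delivers_funpow:
  assumes "delivers p ((step p ^^ t) s) r k"
  shows "delivers p s r k"
proof (cases r)
  case None
  then show ?thesis using assms by (simp add: delivers_def halts_funpow)
next
  case (Some v)
  then obtain u where "(step p ^^ u) ((step p ^^ t) s) = Return v k"
    using assms by (auto simp: delivers_def)
  then have "(step p ^^ (u + t)) s = Return v k" by (simp add: funpow_add)
  then show ?thesis using Some by (auto simp: delivers_def)
qed

lemma delivers_step: "delivers p (step p s) r k \<Longrightarrow> delivers p s r k"
  using delivers_funpow[of p 1 s] by simp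

text \<open>The stack discipline: running two phases one after the other is monadic composition.\<close>

lemma delivers_bind:
  assumes "delivers p s r k'" and "\<And>v. r = Some v \<Longrightarrow> delivers p (Return v k') (g v) k"
  shows "delivers p s (Option.bind r g) k"
proof (cases r)
  case None
  then show ?thesis using assms(1) by (simp add: delivers_def)
next
  case (Some v)
  then obtain t where "(step p ^^ t) s = Return v k'" using assms(1) by (auto simp: delivers_def)
  then have "delivers p ((step p ^^ t) s) (g v) k" using assms(2)[OF Some] by simp
  then have "delivers p s (g v) k" by (rule delivers_funpow)
  then show ?thesis using Some by simp
qed

text \<open>
  An unsuccessful search passes through infinitely many states that are not halted; this is the only
  source of divergence that is not inherited from a subprogram.
\<close>

lemma not_halts_chain:
  assumes chain: "\<And>m. \<exists>t>0. (step p ^^ t) (f m) = f (Suc m)" and "\<And>m. \<not> halted (f m)"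
  shows "\<not> halts p (f 0)"
proof
  assume "halts p (f 0)"
  then obtain u where u: "halted ((step p ^^ u) (f 0))" unfolding halts_def by blast
  have "\<exists>t\<ge>m. (step p ^^ t) (f 0) = f m" for m
  proof (induction m)
    case 0
    show ?case by (auto intro: exI[of _ 0])
  next
    case (Suc m)
    then obtain t where t: "t \<ge> m" "(step p ^^ t) (f 0) = f m" by blast
    obtain t' where t': "t' > 0" "(step p ^^ t') (f m) = f (Suc m)" using chain by blast
    have "(step p ^^ (t' + t)) (f 0) = f (Suc m)" using t t' by (simp add: funpow_add)
    then show ?case using t t' by (intro exI[of _ "t' + t"]) simp
  qed
  then obtain t where "t \<ge> u" "(step p ^^ t) (f 0) = f u" by blast
  then have "f u = (step p ^^ u) (f 0)" using halted_persists[OF u, of t] by simp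
  then show False using u assms(2)[of u] by simp
qed

text \<open>
  The machine computes a primitive recursion upwards, so the induction is on the number of rounds
  already made: the initial state reaches the stack of round \<open>m\<close> with the \<open>m\<close>-th value.
\<close>

lemma delivers_primrec:
  assumes start: "\<And>k. delivers p (Eval c a k) (run p c' a) k"
    and rec: "\<And>x k. delivers p (Eval d x k) (run p d' x) k"
  shows "delivers p (Eval c a \<langle>4, \<langle>\<langle>d, \<langle>a, \<langle>0, n\<rangle>\<rangle>\<rangle>, k\<rangle>\<rangle>) (run p (PrimRec c' d') \<langle>a, n\<rangle>) k"
proof -
  let ?S = "Eval c a \<langle>4, \<langle>\<langle>d, \<langle>a, \<langle>0, n\<rangle>\<rangle>\<rangle>, k\<rangle>\<rangle>"
  let ?K = "\<lambda>m q. \<langle>4, \<langle>\<langle>d, \<langle>a, \<langle>m, q\<rangle>\<rangle>\<rangle>, k\<rangle>\<rangle>"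
  let ?R = "rec_nat (run p c' a) (\<lambda>m r. Option.bind r (\<lambda>y. run p d' \<langle>a, \<langle>m, y\<rangle>\<rangle>))"
  have loop: "m + q = n \<Longrightarrow> delivers p ?S (?R m) (?K m q)" for m q
  proof (induction m arbitrary: q)
    case 0
    then show ?case using start by simp
  next
    case (Suc m)
    have "delivers p (Return y (?K m (Suc q))) (run p d' \<langle>a, \<langle>m, y\<rangle>\<rangle>) (?K (Suc m) q)" for y
      by (rule delivers_step) (simp add: return_step_def primrec_step_def rec)
    moreover have "delivers p ?S (?R m) (?K m (Suc q))" using Suc by simp
    ultimately show ?case by (simp add: delivers_bind)
  qed
  have "delivers p (Return y (?K n 0)) (Some y) k" for y
    by (rule delivers_step) (simp add: return_step_def primrec_step_def delivers_Return)
  with loop[of n 0] have "delivers p ?S (Option.bind (?R n) Some) k"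
    by (intro delivers_bind[of p ?S "?R n" "?K n 0"]) simp_all
  then show ?thesis by simp
qed

text \<open>
  The first position at which the searched function is undefined or zero decides the search: if it
  is zero there, the position is the result, and otherwise the search diverges with that round.  Without such a position the
  rounds form an infinite chain.
\<close>

lemma delivers_minimize:
  assumes body: "\<And>x k. delivers p (Eval c x k) (run p c' x) k"
  shows "delivers p (Eval c \<langle>x, 0\<rangle> \<langle>5, \<langle>\<langle>c, \<langle>x, 0\<rangle>\<rangle>, k\<rangle>\<rangle>) (run p (Minimize c') x) k"
proof -
  let ?S = "\<lambda>m. Eval c \<langle>x, m\<rangle> \<langle>5, \<langle>\<langle>c, \<langle>x, m\<rangle>\<rangle>, k\<rangle>\<rangle>"
  let ?v = "\<lambda>m. run p c' \<langle>x, m\<rangle>"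
  have next_round: "\<exists>t>0. (step p ^^ t) (?S m) = ?S (Suc m)" if y: "?v m = Some y" "y \<noteq> 0" for m y
  proof -
    obtain t where "(step p ^^ t) (?S m) = Return y \<langle>5, \<langle>\<langle>c, \<langle>x, m\<rangle>\<rangle>, k\<rangle>\<rangle>"
      using body[of "\<langle>x, m\<rangle>" "\<langle>5, \<langle>\<langle>c, \<langle>x, m\<rangle>\<rangle>, k\<rangle>\<rangle>"] y(1) by (auto simp: delivers_def)
    then have "(step p ^^ Suc t) (?S m) = ?S (Suc m)"
      using y(2) by (simp add: return_step_def minimize_step_def)
    then show ?thesis by blast
  qed
  show ?thesis
  proof (cases "\<exists>m. ?v m = None \<or> ?v m = Some 0")
    case True
    define n where "n = (LEAST m. ?v m = None \<or> ?v m = Some 0)"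
    have n: "?v n = None \<or> ?v n = Some 0"
      unfolding n_def by (rule LeastI_ex[OF True])
    have before: "\<exists>y. ?v m = Some y \<and> y \<noteq> 0" if "m < n" for m
      using not_less_Least[of m "\<lambda>m. ?v m = None \<or> ?v m = Some 0"] that
      unfolding n_def by auto
    have skip: "delivers p (?S 0) r k" if "delivers p (?S m) r k" "m \<le> n" for m r
      using that
    proof (induction m)
      case 0
      then show ?case by simp
    next
      case (Suc m)
      obtain y where "?v m = Some y" "y \<noteq> 0" using before[of m] Suc.prems by auto
      then obtain t where "(step p ^^ t) (?S m) = ?S (Suc m)" using next_round by blast
      then have "delivers p ((step p ^^ t) (?S m)) r k" using Suc.prems(1) by simp
      then have "delivers p (?S m) r k" by (rule delivers_funpow)
      with Suc show ?case by simp
    qed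
    show ?thesis
    proof (cases "?v n")
      case None
      have "run p (Minimize c') x = None"
      proof -
        have "\<not> (?v m = Some 0 \<and> (\<forall>j<m. ?v j \<noteq> None))" for m
        proof
          assume *: "?v m = Some 0 \<and> (\<forall>j<m. ?v j \<noteq> None)"
          then have "\<not> m < n" using before[of m] by auto
          then show False using * None by (metis linorder_neqE_nat option.distinct(1))
        qed
        then show ?thesis by simp
      qed
      moreover have "delivers p (?S n) None k"
        using body[of "\<langle>x, n\<rangle>"] None by (auto simp: delivers_def)
      ultimately show ?thesis using skip[of n] by simp
    next
      case (Some y)
      with n have zero: "?v n = Some 0" by simp
      have "(LEAST m. ?v m = Some 0) = n"
      proof (rule Least_equality)
        show "?v n = Some 0" by (rule zero)
        show "n \<le> m" if "?v m = Some 0" for m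
          using that before[of m] by (cases "m < n") auto
      qed
      moreover have "\<exists>m. ?v m = Some 0 \<and> (\<forall>j<m. ?v j \<noteq> None)"
        using zero before by (intro exI[of _ n]) auto
      ultimately have "run p (Minimize c') x = Some n" by simp
      moreover have "delivers p (?S n) (Option.bind (?v n) (\<lambda>_. Some n)) k"
      proof (rule delivers_bind[OF body])
        show "delivers p (Return y \<langle>5, \<langle>\<langle>c, \<langle>x, n\<rangle>\<rangle>, k\<rangle>\<rangle>) (Some n) k" if "?v n = Some y" for y
          using that zero
          by - (rule delivers_step, simp add: return_step_def minimize_step_def delivers_Return)
      qed
      ultimately show ?thesis using skip[of n] zero by simp
    qed
  next
    case False
    then have "\<exists>t>0. (step p ^^ t) (?S m) = ?S (Suc m)" for m
      using next_round by (metis option.exhaust)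
    then have "\<not> halts p (?S 0)" by (intro not_halts_chain) auto
    moreover have "run p (Minimize c') x = None" using False by simp
    ultimately show ?thesis by (simp add: delivers_def)
  qed
qed

lemma decode_simps:
  "decode \<langle>0, r\<rangle> = Zero"
  "decode \<langle>Suc 0, r\<rangle> = Succ"
  "decode \<langle>2, r\<rangle> = Fst"
  "decode \<langle>3, r\<rangle> = Snd"
  "decode \<langle>4, r\<rangle> = Oracle"
  "decode \<langle>5, \<langle>a, b\<rangle>\<rangle> = Pairing (decode a) (decode b)"
  "decode \<langle>6, \<langle>a, b\<rangle>\<rangle> = Compose (decode a) (decode b)"
  "decode \<langle>7, \<langle>a, b\<rangle>\<rangle> = PrimRec (decode a) (decode b)"
  "j \<ge> 8 \<Longrightarrow> decode \<langle>j, r\<rangle> = Minimize (decode r)"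
  by (simp_all add: decode.simps[of "prod_encode _"])

lemma program_number_induct:
  assumes basic: "\<And>j r. j < 5 \<Longrightarrow> P \<langle>j, r\<rangle>"
    and binary: "\<And>j a b. j \<in> {5, 6, 7} \<Longrightarrow> P a \<Longrightarrow> P b \<Longrightarrow> P \<langle>j, \<langle>a, b\<rangle>\<rangle>"
    and unary: "\<And>j r. j \<ge> 8 \<Longrightarrow> P r \<Longrightarrow> P \<langle>j, r\<rangle>"
  shows "P e"
proof (induction e rule: less_induct)
  case (less e)
  obtain j r where e: "e = \<langle>j, r\<rangle>" by (metis prod.collapse prod_decode_inverse)
  obtain a b where r: "r = \<langle>a, b\<rangle>" by (metis prod.collapse prod_decode_inverse)
  have "r < e" if "j \<noteq> 0" using snd_prod_decode_less[of e] that by (simp add: e)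
  moreover have "a \<le> r" "b \<le> r" by (simp_all add: r le_prod_encode_1 le_prod_encode_2)
  ultimately have IH: "P r \<and> P a \<and> P b" if "j \<noteq> 0"
    using that less.IH by (meson le_less_trans)
  consider "j < 5" | "j \<in> {5, 6, 7}" | "j \<ge> 8" by fastforce
  then show ?case
  proof cases
    case 1
    then show ?thesis by (simp add: e basic)
  next
    case 2
    then show ?thesis using IH by (auto simp: e r binary)
  next
    case 3
    then show ?thesis using IH by (simp add: e unary)
  qed
qed

text \<open>
  Since the stack is arbitrary, the claim for a program follows from those for its immediate
  subprograms, which the machine evaluates on top of an extended stack.
\<close>

lemma machine_correct: "delivers p (Eval e x k) (run p (decode e) x) k"
proof (induction e arbitrary: x k rule: program_number_induct)
  case (1 j r)
  then consider "j = 0" | "j = 1" | "j = 2" | "j = 3" | "j = 4" by linarith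
  then show ?case
    by cases (rule delivers_step, simp add: eval_step_def decode_simps delivers_Return)+
next
  case (2 j a b)
  from 2(1) consider (pairing) "j = 5" | (composition) "j = 6" | (recursion) "j = 7" by auto
  then show ?case
  proof cases
    case pairing
    have second: "delivers p (Return v \<langle>2, \<langle>u, k\<rangle>\<rangle>) (Some \<langle>u, v\<rangle>) k" for u v
      by (rule delivers_step) (simp add: return_step_def delivers_Return)
    have first: "delivers p (Return u \<langle>1, \<langle>\<langle>b, x\<rangle>, k\<rangle>\<rangle>)
        (Option.bind (run p (decode b) x) (\<lambda>v. Some \<langle>u, v\<rangle>)) k" for u
      by (rule delivers_step) (simp add: return_step_def delivers_bind[OF 2(3) second])
    from delivers_bind[OF 2(2) first] show ?thesis
      by - (rule delivers_step, simp add: pairing eval_step_def decode_simps)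
  next
    case composition
    have "delivers p (Return v \<langle>3, \<langle>a, k\<rangle>\<rangle>) (run p (decode a) v) k" for v
      by (rule delivers_step) (simp add: return_step_def 2(2))
    from delivers_bind[OF 2(3) this] show ?thesis
      by - (rule delivers_step, simp add: composition eval_step_def decode_simps)
  next
    case recursion
    from delivers_primrec[OF 2(2) 2(3), of "nfst x" "nsnd x" k] show ?thesis
      by - (rule delivers_step, simp add: recursion eval_step_def decode_simps del: run.simps)
  qed
next
  case (3 j r)
  show ?case
    by (rule delivers_step)
      (use 3(1) delivers_minimize[OF 3(2)] in \<open>simp add: eval_step_def decode_simps del: run.simps\<close>)
qed

section \<open>The universal program\<close>

text \<open>
  Started with the empty stack, the machine halts exactly when the program converges.  The test
  whether it has halted after \<open>t\<close> steps is total, so the minimization over \<open>t\<close> diverges only if the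
  machine never halts; a halted state no longer changes, so the least \<open>t\<close> shows the final value.
\<close>

theorem universal_program: "\<exists>u. \<forall>p e x. run p u \<langle>e, x\<rangle> = run p (decode e) x"
proof -
  define state where "state p s t = (step p ^^ t) (Eval (nfst s) (nsnd s) 0)" for p s t
  have state: "total_computable (\<lambda>p z. state p (nfst z) (nsnd z))"
    unfolding state_def
    by (intro total_computable_funpow total_computable_step total_computable_Eval
        total_computable_intros)
  define running where
    "running s = (if nfst s = 1 then if nfst (nsnd (nsnd s)) = 0 then 0 else 1 else (1::nat))" for s
  have running: "running s = 0 \<longleftrightarrow> halted s" for s
    by (simp add: running_def halted_def)
  have "total_computable (\<lambda>p z. running (state p (nfst z) (nsnd z)))"
    unfolding running_def by (intro total_computable_intros state)
  then obtain test where
    test: "\<And>p z. run p test z = Some (running (state p (nfst z) (nsnd z)))"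
    by (auto simp: total_computable_def)
  have "total_computable (\<lambda>p z. nfst (nsnd (state p (nfst z) (nsnd z))))"
    by (intro total_computable_intros state)
  then obtain result where
    result: "\<And>p z. run p result z = Some (nfst (nsnd (state p (nfst z) (nsnd z))))"
    by (auto simp: total_computable_def)
  let ?u = "Compose result (Pairing (Pairing Fst Snd) (Minimize test))"
  have "run p ?u \<langle>e, x\<rangle> = run p (decode e) x" for p e x
  proof -
    let ?s = "Eval e x 0"
    let ?T = "LEAST t. halted ((step p ^^ t) ?s)"
    have u: "run p ?u \<langle>e, x\<rangle> =
        (if halts p ?s then Some (nfst (nsnd ((step p ^^ ?T) ?s))) else None)"
      by (simp add: test result running halts_def state_def)
    show ?thesis
    proof (cases "run p (decode e) x")
      case None
      then show ?thesis using machine_correct[of p e x 0] u by (simp add: delivers_def)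
    next
      case (Some v)
      then obtain t where t: "(step p ^^ t) ?s = Return v 0"
        using machine_correct[of p e x 0] by (auto simp: delivers_def)
      then have "halted ((step p ^^ t) ?s)" by simp
      then have "halted ((step p ^^ ?T) ?s)" "?T \<le> t"
        by (rule LeastI, intro Least_le)
      then have "(step p ^^ ?T) ?s = Return v 0" using halted_persists t by metis
      moreover have "halts p ?s" using t unfolding halts_def by (metis halted_Return_empty)
      ultimately show ?thesis using u Some by (simp add: Return_def)
    qed
  qed
  then show ?thesis by blast
qed

section \<open>Computable functionals\<close>

lemma partial_computable_Some:
  assumes "total_computable A"
  shows "partial_computable (\<lambda>p. Some (A p))"
proof -
  obtain c where "\<And>p x. run p c x = Some (A p x)" using assms by (auto simp: total_computable_def)
  then have "(\<lambda>p. Some (A p)) = functional_of c" by (auto simp: functional_of_def)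
  then show ?thesis unfolding partial_computable_def by blast
qed

text \<open>
  Even the index may be computed from the input, since the universal program takes it as an argument.
\<close>

lemma partial_computable_Phi:
  assumes "total_computable (\<lambda>p x. N p)" "total_computable A"
  shows "partial_computable (\<lambda>p. Phi (N p) (A p))"
proof -
  obtain u where u: "\<And>p e x. run p u \<langle>e, x\<rangle> = run p (decode e) x" using universal_program by blast
  obtain u' where u': "\<And>p x. run p u' x = run (A p) u x"
    using oracle_substitution[OF assms(2)] by blast
  obtain d where d: "\<And>p x. run p d x = Some \<langle>N p, x\<rangle>"
    using total_computable_pair[OF assms(1) total_computable_id] by (auto simp: total_computable_def)
  have "run p (Compose u' d) x = run (A p) (decode (N p)) x" for p x
    by (simp add: d u' u)
  then have "functional_of (Compose u' d) = (\<lambda>p. Phi (N p) (A p))"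
    by (auto simp: functional_of_def Phi_def)
  then show ?thesis unfolding partial_computable_def by metis
qed

lemma obtain_index:
  assumes "partial_computable F"
  obtains e where "Phi e = F"
  using assms range_Phi by (metis imageE mem_Collect_eq)

lemma partial_computable_identity: "partial_computable (\<lambda>p. Some p)"
  by (intro partial_computable_Some total_computable_intros)

lemma partial_computable_second: "partial_computable (\<lambda>z. Some (\<lambda>n. z (Suc (2 * n))))"
  by (intro partial_computable_Some total_computable_intros total_computable_double)

lemma bpair_second: "(\<lambda>n. bpair p q (Suc (2 * n))) = q"
  by (simp add: bpair_def)

lemma partial_computable_btriple: "partial_computable (\<lambda>p. Some (btriple e i p))"
proof -
  have "btriple e i = (\<lambda>p n. if n = 0 then e else if n = 1 then i else p (n - 1 - 1))"
    by (auto simp: fun_eq_iff btriple_def split: nat.split)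
  moreover have "total_computable \<dots>" by (intro total_computable_intros)
  ultimately show ?thesis using partial_computable_Some by metis
qed

section \<open>Totalizations and the tot-jump\<close>

lemma weihrauch_le_refl: "f \<le>\<^sub>W f"
  unfolding weihrauch_le_def
  by (intro exI[of _ "\<lambda>p. Some p"] exI[of _ "\<lambda>z. Some (\<lambda>n. z (Suc (2 * n)))"])
    (auto simp: partial_computable_identity partial_computable_second bpair_second)

lemma tot_jump_nonempty: "tot_jump f x \<noteq> {}"
  by (auto simp: tot_jump_def tot_jump_at_def pdom_def)

lemma tot_jump_bound:
  assumes "g \<le>\<^sub>W f"
  shows "totalization g \<le>\<^sub>W tot_jump f"
proof -
  obtain F G where "partial_computable F" "partial_computable G"
    and red: "\<And>p. p \<in> pdom g \<Longrightarrow>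
      \<exists>r. F p = Some r \<and> r \<in> pdom f \<and> (\<forall>q\<in>f r. \<exists>s. G (bpair p q) = Some s \<and> s \<in> g p)"
    using assms unfolding weihrauch_le_def by blast
  then obtain e i where ei: "Phi e = F" "Phi i = G" by (metis obtain_index)
  have "tot_jump f (btriple e i p) \<subseteq> totalization g p" for p
  proof (cases "p \<in> pdom g")
    case True
    then obtain r where r: "F p = Some r" "r \<in> pdom f"
      "\<And>q. q \<in> f r \<Longrightarrow> \<exists>s. G (bpair p q) = Some s \<and> s \<in> g p"
      using red by blast
    then have "\<exists>r. Phi e p = Some r \<and> r \<in> pdom f \<and> (\<forall>q\<in>f r. Phi i (bpair p q) \<noteq> None)"
      unfolding ei by (metis option.distinct(1))
    then have "tot_jump f (btriple e i p) = {the (G (bpair p q)) | q. q \<in> f r}"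
      by (simp only: tot_jump_btriple tot_jump_at_def if_True) (simp add: ei r(1))
    moreover have "the (G (bpair p q)) \<in> g p" if "q \<in> f r" for q
      using r(3)[OF that] by auto
    ultimately show ?thesis using True by (auto simp: totalization_def)
  next
    case False
    then show ?thesis by (simp add: totalization_def)
  qed
  then show ?thesis
    unfolding weihrauch_le_def
    by (intro exI[of _ "\<lambda>p. Some (btriple e i p)"] exI[of _ "\<lambda>z. Some (\<lambda>n. z (Suc (2 * n)))"])
      (auto simp: partial_computable_btriple partial_computable_second bpair_second pdom_def
        tot_jump_nonempty)
qed

definition is_reduction_at :: "problem \<Rightarrow> baire \<Rightarrow> bool" where
  "is_reduction_at f x \<longleftrightarrow>
     (\<exists>r. Phi (x 0) (\<lambda>n. x (n + 2)) = Some r \<and> r \<in> pdom f \<and>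
       (\<forall>q\<in>f r. Phi (x 1) (bpair (\<lambda>n. x (n + 2)) q) \<noteq> None))"

definition tot_jump_core :: "problem \<Rightarrow> problem" where
  "tot_jump_core f x = (if is_reduction_at f x then tot_jump f x else {})"

lemma pdom_tot_jump_core: "x \<in> pdom (tot_jump_core f) \<longleftrightarrow> is_reduction_at f x"
  by (simp add: pdom_def tot_jump_core_def tot_jump_nonempty)

lemma tot_jump_cases:
  "tot_jump f x =
     (if is_reduction_at f x
      then {the (Phi (x 1) (bpair (\<lambda>n. x (n + 2)) q)) | q. q \<in> f (the (Phi (x 0) (\<lambda>n. x (n + 2))))}
      else UNIV)"
  by (simp only: tot_jump_def tot_jump_at_def is_reduction_at_def)

lemma totalization_tot_jump_core: "totalization (tot_jump_core f) = tot_jump f"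
  by (rule ext) (simp add: totalization_def pdom_tot_jump_core tot_jump_core_def tot_jump_cases)

lemma tot_jump_core_le: "tot_jump_core f \<le>\<^sub>W f"
proof -
  define F where "F x = Phi (x 0) (\<lambda>n. x (n + 2))" for x :: baire
  \<comment> \<open>In \<open>bpair x q\<close> with \<open>x = btriple e i p\<close>, the positions 0 and 2 hold \<open>e\<close> and \<open>i\<close>; reading the even
      positions from 4 on and all the odd ones gives \<open>bpair p q\<close>.\<close>
  define G where "G z = Phi (z 2) (\<lambda>n. if even n then z (Suc (Suc (Suc (Suc n)))) else z n)"
    for z :: baire
  have G: "G (bpair x q) = Phi (x 1) (bpair (\<lambda>n. x (n + 2)) q)" for x q
  proof -
    have "(\<lambda>n. if even n then bpair x q (Suc (Suc (Suc (Suc n)))) else bpair x q n) =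
        bpair (\<lambda>n. x (n + 2)) q"
      by (auto simp: bpair_def fun_eq_iff)
    moreover have "bpair x q 2 = x 1" by (simp add: bpair_def)
    ultimately show ?thesis by (simp only: G_def)
  qed
  have "partial_computable F"
    unfolding F_def
    by (intro partial_computable_Phi total_computable_intros) (simp, intro total_computable_intros)
  moreover have "partial_computable G"
    unfolding G_def
    by (intro partial_computable_Phi total_computable_parity_if total_computable_intros)
  moreover have "\<exists>r. F x = Some r \<and> r \<in> pdom f \<and>
      (\<forall>q\<in>f r. \<exists>s. G (bpair x q) = Some s \<and> s \<in> tot_jump_core f x)"
    if "x \<in> pdom (tot_jump_core f)" for x
  proof -
    have x: "is_reduction_at f x" using that by (simp add: pdom_tot_jump_core)
    then obtain r where r: "F x = Some r" "r \<in> pdom f" "\<forall>q\<in>f r. G (bpair x q) \<noteq> None"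
      unfolding is_reduction_at_def F_def G by blast
    then have "tot_jump_core f x = {the (G (bpair x q)) | q. q \<in> f r}"
      using x by (simp add: tot_jump_core_def tot_jump_cases G F_def)
    then show ?thesis using r by fastforce
  qed
  ultimately show ?thesis unfolding weihrauch_le_def by blast
qed

text \<open>
  With indices of the identity and of the second projection, the core at \<open>p\<close> is \<open>f p\<close> itself.
\<close>

lemma le_tot_jump_core: "f \<le>\<^sub>W tot_jump_core f"
proof -
  obtain e where e: "Phi e = (\<lambda>p. Some p)"
    by (rule obtain_index[OF partial_computable_identity])
  obtain i where i: "Phi i = (\<lambda>z. Some (\<lambda>n. z (Suc (2 * n))))"
    by (rule obtain_index[OF partial_computable_second])
  have shift: "(\<lambda>n. btriple e i p (n + 2)) = p" for p
    by (simp add: btriple_def)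
  have "tot_jump_core f (btriple e i p) = f p" if "p \<in> pdom f" for p
  proof -
    have "is_reduction_at f (btriple e i p)"
      unfolding is_reduction_at_def shift using that by (simp add: btriple_def e i)
    then show ?thesis
      using that by (simp add: tot_jump_core_def tot_jump_btriple tot_jump_at_def e i bpair_second)
  qed
  then show ?thesis
    unfolding weihrauch_le_def
    by (intro exI[of _ "\<lambda>p. Some (btriple e i p)"] exI[of _ "\<lambda>z. Some (\<lambda>n. z (Suc (2 * n)))"])
      (auto simp: partial_computable_btriple partial_computable_second bpair_second pdom_def)
qed

text \<open>
  The core of \<open>f\<close> witnesses that the degree of the tot-jump is attained, and it belongs to both
  families of problems; that the degree is an upper bound is \<open>tot_jump_bound\<close>.
\<close>

theorem theorem3p3:
  fixes f :: problem
  shows "(\<forall>g::problem. g \<le>\<^sub>W f \<longrightarrow> totalization g \<le>\<^sub>W tot_jump f) \<and>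
    (\<exists>h::problem. h \<equiv>\<^sub>W f \<and> tot_jump f \<equiv>\<^sub>W totalization h) \<and>
    is_max_degree (weihrauch_degree (tot_jump f))
      {weihrauch_degree (totalization g) | g. g \<equiv>\<^sub>W f} \<and>
    is_max_degree (weihrauch_degree (tot_jump f))
      {weihrauch_degree (totalization g) | g. g \<le>\<^sub>W f}"
proof -
  have core: "tot_jump_core f \<equiv>\<^sub>W f"
    by (simp add: weihrauch_equiv_def tot_jump_core_le le_tot_jump_core)
  have own: "g \<in> weihrauch_degree g" for g
    by (simp add: weihrauch_degree_def weihrauch_equiv_def weihrauch_le_refl)
  have max: "is_max_degree (weihrauch_degree (tot_jump f))
      {weihrauch_degree (totalization g) | g. Q g}"
    if "Q (tot_jump_core f)" "\<And>g. Q g \<Longrightarrow> g \<le>\<^sub>W f" for Q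
    unfolding is_max_degree_def
  proof (intro conjI ballI)
    show "weihrauch_degree (tot_jump f) \<in> {weihrauch_degree (totalization g) | g. Q g}"
      using that(1) totalization_tot_jump_core by (metis (mono_tags, lifting) mem_Collect_eq)
    show "degree_le E (weihrauch_degree (tot_jump f))"
      if "E \<in> {weihrauch_degree (totalization g) | g. Q g}" for E
      using that \<open>\<And>g. Q g \<Longrightarrow> g \<le>\<^sub>W f\<close> own tot_jump_bound unfolding degree_le_def by blast
  qed
  have "tot_jump f \<equiv>\<^sub>W totalization (tot_jump_core f)"
    by (simp add: totalization_tot_jump_core weihrauch_equiv_def weihrauch_le_refl)
  then show ?thesis
    using core tot_jump_bound max[of "\<lambda>g. g \<equiv>\<^sub>W f"] max[of "\<lambda>g. g \<le>\<^sub>W f"] tot_jump_core_le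
    by (auto simp: weihrauch_equiv_def)
qed

end
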